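(* Let $n\ge1$ and $r\ge0$ be integers. Then $$\bar M^{(n)}_{2r}(0;2)=\frac{2^{2r-1}n\binom{2n}{n}}{\binom{2r+2n-2}{r+n-1}}-2(n-1).$$
   Context: A walk is a lattice path in $\mathbb Z^2$ with steps $(1,1)$ and $(1,-1)$ never going below the $x$-axis. A family of walks is vicious if no two of its walks share a lattice point. A contact is a lattice point on the $x$-axis lying on one of the walks (starting and end points included); $c(\mathbf P)$ is the total number of contacts of a family $\mathbf P$. $Z^{(n)}_t(y;\kappa)=\sum_{\mathbf P}\kappa^{c(\mathbf P)}$, summed over vicious families $(P_1,\dots,P_n)$ with $P_i$ running from $(0,2i-2)$ to $(t,y+2i-2)$. The normalized mean number of contacts is $\bar M^{(n)}_t(y;\kappa)=\kappa\frac{d}{d\kappa}Z^{(n)}_t(y;\kappa)\big/Z^{(n)}_t(y;\kappa)$. *)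

theory Defs
  imports "HOL-Analysis.Analysis"
begin

text \<open>A walk is the nonempty list of the lattice points it visits, in order.\<close>

definition walk :: "(int \<times> int) list \<Rightarrow> bool" where
  "walk P \<longleftrightarrow> P \<noteq> [] \<and>
     successively (\<lambda>(a, b) (c, d). c = a + 1 \<and> (d = b + 1 \<or> d = b - 1)) P \<and>
     (\<forall>p\<in>set P. 0 \<le> snd p)"

definition walk_between :: "int \<times> int \<Rightarrow> int \<times> int \<Rightarrow> (int \<times> int) list \<Rightarrow> bool" where
  "walk_between u v P \<longleftrightarrow> walk P \<and> hd P = u \<and> last P = v"

definition vicious :: "(int \<times> int) list list \<Rightarrow> bool" where
  "vicious Ps \<longleftrightarrow>
     (\<forall>i<length Ps. \<forall>j<length Ps. i \<noteq> j \<longrightarrow> set (Ps ! i) \<inter> set (Ps ! j) = {})"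

definition contacts :: "(int \<times> int) list list \<Rightarrow> nat" where
  "contacts Ps = card {p. (\<exists>P\<in>set Ps. p \<in> set P) \<and> snd p = 0}"

text \<open>Indices are zero-based: the walk called $P_i$ with $1 \le i \le n$ is the list entry
  with index $i - 1$, hence the shift by $2i$ instead of $2i-2$.\<close>

definition vicious_families :: "nat \<Rightarrow> nat \<Rightarrow> int \<Rightarrow> (int \<times> int) list list set" where
  "vicious_families n t y = {Ps. length Ps = n \<and> vicious Ps \<and>
     (\<forall>i<n. walk_between (0, 2 * int i) (int t, y + 2 * int i) (Ps ! i))}"

definition partition_function :: "nat \<Rightarrow> nat \<Rightarrow> int \<Rightarrow> real \<Rightarrow> real" where
  "partition_function n t y \<kappa> = (\<Sum>Ps\<in>vicious_families n t y. \<kappa> ^ contacts Ps)"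

definition mean_contacts :: "nat \<Rightarrow> nat \<Rightarrow> int \<Rightarrow> real \<Rightarrow> real" where
  "mean_contacts n t y \<kappa> =
     \<kappa> * deriv (partition_function n t y) \<kappa> / partition_function n t y \<kappa>"

text \<open>The sum above is a genuine finite sum.\<close>

lemma walk_points:
  assumes "walk P" "k < length P"
  shows "fst (P ! k) = fst (hd P) + int k \<and> \<bar>snd (P ! k) - snd (hd P)\<bar> \<le> int k"
  using assms(2)
proof (induction k)
  case 0
  then show ?case by (simp add: hd_conv_nth)
next
  case (Suc k)
  have "case (P ! k, P ! Suc k) of ((a, b), (c, d)) \<Rightarrow> c = a + 1 \<and> (d = b + 1 \<or> d = b - 1)"
    using assms(1) Suc.prems by (auto simp: walk_def successively_conv_nth)
  then show ?case using Suc by (auto split: prod.splits)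
qed

lemma finite_vicious_families: "finite (vicious_families n t y)"
proof -
  define B where "B = {0..int t} \<times> {0..2 * int n + int t}"
  define W where "W = {P. set P \<subseteq> B \<and> length P = Suc t}"
  have "finite W" unfolding W_def by (rule finite_lists_length_eq) (simp add: B_def)
  moreover have "Ps ! i \<in> W" if "Ps \<in> vicious_families n t y" "i < n" for Ps i
  proof -
    let ?P = "Ps ! i"
    have w: "walk ?P" "hd ?P = (0, 2 * int i)" "last ?P = (int t, y + 2 * int i)"
      using that by (auto simp: vicious_families_def walk_between_def)
    have ne: "?P \<noteq> []" using w(1) by (simp add: walk_def)
    have "int (length ?P - 1) = int t"
      using walk_points[OF w(1), of "length ?P - 1"] ne w by (simp add: last_conv_nth)
    then have len: "length ?P = Suc t" using ne by (cases ?P) auto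
    have "?P ! k \<in> B" if "k < length ?P" for k
    proof -
      have "0 \<le> snd (?P ! k)" using w(1) that by (simp add: walk_def)
      then show ?thesis using walk_points[OF w(1) that] w(2) that len \<open>i < n\<close>
        by (cases "?P ! k") (auto simp: B_def)
    qed
    then have "set ?P \<subseteq> B" by (metis in_set_conv_nth subsetI)
    then show ?thesis using len by (simp add: W_def)
  qed
  then have "vicious_families n t y \<subseteq> {Ps. set Ps \<subseteq> W \<and> length Ps = n}"
    by (auto simp: in_set_conv_nth vicious_families_def)
  ultimately show ?thesis
    using finite_lists_length_eq[of W n] finite_subset by blast
qed

end

theory Submission
  imports Defs "Jordan_Normal_Form.Determinant"
begin

text \<open>As a function of the end points, the weighted count of vicious families obeys a one-step
  recursion that a determinant of one-walk weights obeys too (the Lindstroem-Gessel-Viennot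
  determinant, obtained without path switching). The initial and final
  points are those of walks forced out of the origin, so the determinant becomes the Hankel
  determinant of $\mu_m(\kappa)$, the weighted count of Dyck paths of length $2m$, up to the factor
  $\kappa^{2(n-1)}$ that causes the term $-2(n-1)$. At $\kappa = 2$ one has
  $\mu_m = 2\binom{2m}{m}$ and $\mu_m' = 4^m$: the derivative of the Hankel matrix has rank one,
  and its logarithmic derivative is the value at $4$ of the kernel polynomial of the moments
  $\binom{2(r+m)}{r+m}$, whose coefficients are explicit.\<close>

subsection \<open>The kernel polynomial of shifted central binomial moments\<close>

text \<open>The sum is, up to sign, the \<open>N\<close>-th finite difference of a monic polynomial
  of degree \<open>l\<close>: zero for \<open>l < N\<close>, and \<open>N!\<close> for
  \<open>l = N\<close>. The offsets \<open>a\<close> stay arbitrary because the absorption identity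
  replaces \<open>j\<close> by \<open>Suc j\<close> and thereby raises every offset by one.\<close>

lemma alternating_binomial_prod:
  fixes a :: "nat \<Rightarrow> real"
  assumes "l \<le> N"
  shows "(\<Sum>j\<le>N. (-1) ^ j * real (N choose j) * (\<Prod>k<l. real j + a k)) =
    (if l = N then (-1) ^ N * fact N else 0)"
  using assms
proof (induction l arbitrary: N a)
  case 0
  then show ?case using choose_alternating_sum[of N, where 'a = real] by auto
next
  case (Suc l)
  then obtain M where N: "N = Suc M" by (cases N) auto
  define P where "P j = (\<Prod>k<l. real j + a k)" for j
  have P_Suc: "P (Suc j) = (\<Prod>k<l. real j + (a k + 1))" for j
    by (simp add: P_def algebra_simps)
  have absorb: "real (Suc j) * real (Suc M choose Suc j) = real (Suc M) * real (M choose j)" for j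
    by (metis Suc_times_binomial_eq mult.commute of_nat_mult)
  \<comment> \<open>Split the last factor \<open>real j + a l\<close>: the constant part has degree
    \<open>l < N\<close> and vanishes, the part with \<open>j\<close> is absorbed into a binomial of
    row \<open>M\<close>.\<close>
  have "(\<Sum>j\<le>N. (-1) ^ j * real (N choose j) * (\<Prod>k<Suc l. real j + a k)) =
    (\<Sum>j\<le>N. (-1) ^ j * (real j * real (N choose j)) * P j)
      + a l * (\<Sum>j\<le>N. (-1) ^ j * real (N choose j) * P j)"
    unfolding sum_distrib_left sum.distrib[symmetric]
    by (intro sum.cong) (auto simp: P_def algebra_simps)
  also have "(\<Sum>j\<le>N. (-1) ^ j * real (N choose j) * P j) = 0"
    unfolding P_def using Suc.IH[of N a] Suc.prems by simp
  also have "(\<Sum>j\<le>N. (-1) ^ j * (real j * real (N choose j)) * P j) =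
     (\<Sum>j\<le>M. (-1) ^ Suc j * (real (Suc M) * real (M choose j)) * P (Suc j))"
    unfolding N sum.atMost_Suc_shift absorb by simp
  also have "\<dots> = - real (Suc M) * (\<Sum>j\<le>M. (-1) ^ j * real (M choose j) * P (Suc j))"
    unfolding sum_distrib_left by (intro sum.cong) (auto simp: algebra_simps)
  also have "\<dots> = - real (Suc M) * (if l = M then (-1) ^ M * fact M else 0)"
    unfolding P_Suc using Suc.IH[of M] Suc.prems N by simp
  also have "- real (Suc M) * (if l = M then (-1) ^ M * fact M else 0) + a l * 0 =
      (if Suc l = N then (-1) ^ N * fact N else 0)"
    by (simp add: N algebra_simps)
  finally show ?case .
qed

lemma central_binomial_Suc:
  "real (Suc m) * real ((2 * Suc m) choose Suc m) = 4 * (real m + 1/2) * real ((2 * m) choose m)"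
proof -
  let ?f = "fact m :: real"
  have "(real (Suc m) * ?f * ?f) * (real (Suc m) * real ((2 * Suc m) choose Suc m)) = fact (2 * Suc m)"
    using binomial_fact[of "Suc m" "2 * Suc m", where 'a = real] by simp
  also have "\<dots> = real (Suc m) * (4 * (real m + 1/2)) * fact (2 * m)"
    by (simp add: algebra_simps)
  also have "fact (2 * m) = ?f * ?f * real ((2 * m) choose m)"
    using binomial_fact[of m "2 * m", where 'a = real] by simp
  also have "real (Suc m) * (4 * (real m + 1/2)) * (?f * ?f * real ((2 * m) choose m)) =
    (real (Suc m) * ?f * ?f) * (4 * (real m + 1/2) * real ((2 * m) choose m))"
    by (simp only: mult_ac)
  finally show ?thesis by (subst (asm) mult_cancel_left) simp
qed

text \<open>The product of \<open>i\<close> consecutive ratios of central binomials, with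
  denominators cleared.\<close>

lemma central_binomial_add:
  "real ((2 * (s + i)) choose (s + i)) * pochhammer (real s + 1) i =
    4 ^ i * real ((2 * s) choose s) * pochhammer (real s + 1/2) i"
proof (induction i)
  case (Suc i)
  let ?c = "\<lambda>m. real ((2 * m) choose m)"
  have "?c (s + Suc i) * pochhammer (real s + 1) (Suc i) =
    (real (Suc (s + i)) * ?c (Suc (s + i))) * pochhammer (real s + 1) i"
    by (simp add: pochhammer_Suc algebra_simps)
  also have "\<dots> = 4 * (real (s + i) + 1/2) * (?c (s + i) * pochhammer (real s + 1) i)"
    unfolding central_binomial_Suc by (simp only: mult_ac)
  also have "\<dots> = 4 ^ Suc i * ?c s * pochhammer (real s + 1/2) (Suc i)"
    unfolding Suc.IH by (simp add: pochhammer_Suc)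
  finally show ?case .
qed simp

lemma fact_add: "(fact (s + i) :: real) = fact s * pochhammer (real s + 1) i"
  by (induction i) (auto simp: pochhammer_Suc algebra_simps)

lemma binomial_pochhammer: "real ((N + s) choose N) * fact N = pochhammer (real s + 1) N"
  using fact_add[of s N] binomial_fact[of N "N + s", where 'a = real] by (simp add: add.commute field_simps)

text \<open>The terminating Gauss sum 2F1(-N, A; B; 1). Pascal's rule writes row
  \<open>Suc N\<close> as the sum for \<open>(A, B)\<close> minus a multiple of the sum for
  \<open>(A + 1, B + 1)\<close>, so both parameters must vary in the induction.\<close>

lemma chu_vandermonde:
  fixes A B :: real
  assumes "0 < B"
  shows "(\<Sum>j\<le>N. (-1) ^ j * real (N choose j) * (pochhammer A j / pochhammer B j)) =
    pochhammer (B - A) N / pochhammer B N"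
  using assms
proof (induction N arbitrary: A B)
  case (Suc N)
  define f where "f j = pochhammer A j / pochhammer B j" for j
  have f_Suc: "f (Suc j) = A / B * (pochhammer (A + 1) j / pochhammer (B + 1) j)" for j
    by (simp add: f_def pochhammer_rec)
  have "(\<Sum>j\<le>Suc N. (-1) ^ j * real (Suc N choose j) * f j) =
    f 0 + (\<Sum>j\<le>N. (-1) ^ Suc j * real (N choose Suc j) * f (Suc j))
      - (\<Sum>j\<le>N. (-1) ^ j * real (N choose j) * f (Suc j))"
    unfolding sum.atMost_Suc_shift by (simp add: algebra_simps sum.distrib sum_negf sum_subtractf)
  also have "f 0 + (\<Sum>j\<le>N. (-1) ^ Suc j * real (N choose Suc j) * f (Suc j)) =
    (\<Sum>j\<le>Suc N. (-1) ^ j * real (N choose j) * f j)"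
    unfolding sum.atMost_Suc_shift by simp
  also have "\<dots> = (\<Sum>j\<le>N. (-1) ^ j * real (N choose j) * f j)" by simp
  also have "\<dots> = pochhammer (B - A) N / pochhammer B N"
    unfolding f_def using Suc.IH[OF Suc.prems] .
  also have "(\<Sum>j\<le>N. (-1) ^ j * real (N choose j) * f (Suc j)) =
     A / B * (\<Sum>j\<le>N. (-1) ^ j * real (N choose j) * (pochhammer (A + 1) j / pochhammer (B + 1) j))"
    unfolding f_Suc sum_distrib_left by (intro sum.cong) (auto simp: mult_ac)
  also have "\<dots> = A / B * (pochhammer (B - A) N / pochhammer (B + 1) N)"
    using Suc.IH[of "B + 1" "A + 1"] Suc.prems by simp
  also have "pochhammer (B - A) N / pochhammer B N - \<dots> =
     pochhammer (B - A) (Suc N) / pochhammer B (Suc N)"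
  proof -
    have pos: "pochhammer B N > 0" "pochhammer (B + 1) N > 0" "B + real N > 0"
      using Suc.prems by (auto intro!: pochhammer_pos)
    \<comment> \<open>This brings both terms over \<open>pochhammer B (Suc N)\<close>; the numerator
      factor left is \<open>(B + N) - A\<close>, the last factor of
      \<open>pochhammer (B - A) (Suc N)\<close>.\<close>
    have e: "B * pochhammer (B + 1) N = pochhammer B N * (B + real N)"
      by (metis pochhammer_Suc pochhammer_rec)
    have e': "A / B * (pochhammer (B - A) N / pochhammer (B + 1) N) =
       A * pochhammer (B - A) N / (pochhammer B N * (B + real N))" by (simp flip: e)
    show ?thesis unfolding e' pochhammer_Suc using pos
      by (simp add: divide_simps) (simp add: algebra_simps)
  qed
  finally show ?case by (simp add: f_def)
qed simp

text \<open>Coefficients of the polynomial K of degree \<open>N\<close> that represents evaluation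
  at 4: with L the functional sending x^m to the central binomial of index \<open>r + m\<close>, L(p
  K) = p(4) for every p of degree at most \<open>N\<close>.\<close>

definition kernel_coeff :: "nat \<Rightarrow> nat \<Rightarrow> nat \<Rightarrow> real" where
  "kernel_coeff r N j = (-1) ^ (N + j) * real (N choose j) * real ((N + (r + j)) choose N)
     / real ((2 * (r + j)) choose (r + j))"

text \<open>Division by the central binomial in \<open>kernel_coeff\<close> turns each summand into
  a signed binomial times a monic polynomial of degree \<open>N\<close> in \<open>j\<close>, so only
  its leading coefficient survives the finite difference.\<close>

lemma central_binomial_kernel_coeff:
  assumes "i \<le> N"
  shows "(\<Sum>j\<le>N. real ((2 * (r + i + j)) choose (r + i + j)) * kernel_coeff r N j) = 4 ^ i"
proof -
  \<comment> \<open>With s = r + j, the ratio of central binomials gives \<open>i\<close>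
    half-integer factors over the first \<open>i\<close> factors of
    \<open>pochhammer (real s + 1) N\<close>; cancelling leaves the half-integer factors for k < i
    and the integer ones for k >= i.\<close>
  define a where "a k = real r + real k + (if k < i then 1/2 else 1)" for k
  have prod: "real ((2 * (s + i)) choose (s + i)) * pochhammer (real s + 1) N =
      4 ^ i * real ((2 * s) choose s) * (\<Prod>k<N. real j + a k)" if s: "s = r + j" for s j
  proof -
    have "{..<N} = {..<i} \<union> {i..<N}" using assms by auto
    then have "(\<Prod>k<N. real j + a k) = (\<Prod>k<i. real j + a k) * (\<Prod>k=i..<N. real j + a k)"
      by (simp add: prod.union_disjoint ivl_disj_int)
    also have "(\<Prod>k<i. real j + a k) = pochhammer (real s + 1/2) i"
      by (simp add: pochhammer_prod a_def s lessThan_atLeast0 add_ac)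
    also have "(\<Prod>k=i..<N. real j + a k) = (\<Prod>k=i..<N. (real s + 1) + real k)"
      by (intro prod.cong) (auto simp: a_def s)
    finally have "4 ^ i * real ((2 * s) choose s) * (\<Prod>k<N. real j + a k) =
       real ((2 * (s + i)) choose (s + i)) *
         (pochhammer (real s + 1) i * (\<Prod>k=i..<N. (real s + 1) + real k))"
      using central_binomial_add[of s i] by (simp add: mult_ac)
    also have "pochhammer (real s + 1) i * (\<Prod>k=i..<N. (real s + 1) + real k) = pochhammer (real s + 1) N"
      unfolding pochhammer_prod using assms by (subst prod.atLeastLessThan_concat) auto
    finally show ?thesis by simp
  qed
  have "real ((2 * (r + i + j)) choose (r + i + j)) * kernel_coeff r N j =
      4 ^ i * (-1) ^ N / fact N * ((-1) ^ j * real (N choose j) * (\<Prod>k<N. real j + a k))" for j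
  proof -
    have "real ((2 * (r + i + j)) choose (r + i + j)) * kernel_coeff r N j * fact N
        * real ((2 * (r + j)) choose (r + j)) =
      (-1) ^ (N + j) * real (N choose j) * (real ((2 * (r + j + i)) choose (r + j + i)) *
        (real ((N + (r + j)) choose N) * fact N))"
      by (simp add: kernel_coeff_def add_ac)
    also have "\<dots> = (-1) ^ (N + j) * real (N choose j) *
       (4 ^ i * real ((2 * (r + j)) choose (r + j)) * (\<Prod>k<N. real j + a k))"
      unfolding binomial_pochhammer prod[OF refl] ..
    finally show ?thesis by (simp add: field_simps power_add)
  qed
  then have "(\<Sum>j\<le>N. real ((2 * (r + i + j)) choose (r + i + j)) * kernel_coeff r N j) =
     4 ^ i * (-1) ^ N / fact N * (\<Sum>j\<le>N. (-1) ^ j * real (N choose j) * (\<Prod>k<N. real j + a k))"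
    by (simp add: sum_distrib_left)
  also have "\<dots> = 4 ^ i * ((-1) ^ N * (-1) ^ N)"
    by (simp add: alternating_binomial_prod)
  finally show ?thesis by (simp flip: power_add)
qed

text \<open>K(4) is a hypergeometric sum with A = N + r + 1 and B = r + 1/2, so
  \<open>chu_vandermonde\<close> evaluates it; B - A = -N - 1/2 does not involve
  \<open>r\<close>.\<close>

lemma kernel_coeff_at_endpoint:
  "(\<Sum>j\<le>N. 4 ^ j * kernel_coeff r N j) =
     real (Suc N) * real ((2 * Suc N) choose Suc N) / (2 * real ((2 * (r + N)) choose (r + N)))"
proof -
  let ?c = "\<lambda>m. real ((2 * m) choose m)"
  have pos: "pochhammer (real r + 1) j > 0" "pochhammer (real r + 1/2) j > 0" for j
    by (auto intro!: pochhammer_pos)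
  have "4 ^ j * kernel_coeff r N j = (-1) ^ N * real ((N + r) choose N) / ?c r *
     ((-1) ^ j * real (N choose j) * (pochhammer (real (N + r) + 1) j / pochhammer (real r + 1/2) j))" for j
  proof -
    have 1: "?c (r + j) = 4 ^ j * ?c r * pochhammer (real r + 1/2) j / pochhammer (real r + 1) j"
      using central_binomial_add[of r j] pos[of j] by (simp add: field_simps)
    have "(fact N * fact r) * (real ((N + (r + j)) choose N) * pochhammer (real r + 1) j) =
       fact N * fact (r + j) * real ((N + (r + j)) choose N)"
      by (simp add: fact_add[of r j])
    also have "\<dots> = fact (N + r + j)"
      using binomial_fact[of N "N + (r + j)", where 'a = real] by (simp add: add_ac)
    also have "\<dots> = fact (N + r) * pochhammer (real (N + r) + 1) j" by (rule fact_add)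
    also have "fact (N + r) = fact N * fact r * real ((N + r) choose N)"
      using binomial_fact[of N "N + r", where 'a = real] by simp
    finally have "real ((N + (r + j)) choose N) * pochhammer (real r + 1) j =
       real ((N + r) choose N) * pochhammer (real (N + r) + 1) j"
      by simp
    then have 2: "real ((N + (r + j)) choose N) =
       real ((N + r) choose N) * pochhammer (real (N + r) + 1) j / pochhammer (real r + 1) j"
      using pos[of j] by (simp add: field_simps)
    show ?thesis unfolding kernel_coeff_def 1 2 using pos[of j]
      by (simp add: field_simps power_add)
  qed
  then have "(\<Sum>j\<le>N. 4 ^ j * kernel_coeff r N j) = (-1) ^ N * real ((N + r) choose N) / ?c r *
    (\<Sum>j\<le>N. (-1) ^ j * real (N choose j) * (pochhammer (real (N + r) + 1) j / pochhammer (real r + 1/2) j))"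
    by (simp add: sum_distrib_left)
  also have "\<dots> = real ((N + r) choose N) / ?c r *
      ((-1) ^ N * pochhammer (- real N - 1/2) N) / pochhammer (real r + 1/2) N"
    by (subst chu_vandermonde) (auto simp: algebra_simps)
  also have "(-1) ^ N * pochhammer (- real N - 1/2) N = pochhammer (3/2 :: real) N"
    using pochhammer_minus[of "real N + 1/2" N] by (simp add: algebra_simps flip: power_add)
  \<comment> \<open>The factor \<open>?c (r + N)\<close> is inserted above and below so that
    \<open>central_binomial_add\<close> can cancel the half-integer Pochhammer symbol.\<close>
  also have "real ((N + r) choose N) = ?c (r + N) * pochhammer (real r + 1) N / (?c (r + N) * fact N)"
    using binomial_pochhammer[of N r] by (simp add: field_simps)
  also have "\<dots> = 4 ^ N * ?c r * pochhammer (real r + 1/2) N / (?c (r + N) * fact N)"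
    unfolding central_binomial_add ..
  also have "\<dots> / ?c r * pochhammer (3/2 :: real) N / pochhammer (real r + 1/2) N =
     4 ^ N * pochhammer (3/2) N / (?c (r + N) * fact N)"
    using pos[of N] by (simp add: field_simps)
  also have "4 ^ N * pochhammer (3/2 :: real) N = ?c (Suc N) * fact (Suc N) / 2"
    using central_binomial_add[of 0 "Suc N"] fact_add[of 0 "Suc N"] by (simp add: pochhammer_rec)
  also have "x * fact (Suc N) / 2 / (y * fact N) = real (Suc N) * x / (2 * y)" for x y :: real
    by (cases "y = 0") (simp_all add: field_simps)
  finally show ?thesis .
qed

subsection \<open>Weights of a single walk and their Hankel determinant\<close>

text \<open>Walks from the origin to height \<open>x\<close> in \<open>t\<close> steps, weighted by
  \<open>\<kappa>\<close> per contact. The starting point is a contact, hence the value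
  \<open>\<kappa>\<close> at time 0.\<close>

primrec walk_weight :: "real \<Rightarrow> nat \<Rightarrow> int \<Rightarrow> real" where
  "walk_weight \<kappa> 0 x = (if x = 0 then \<kappa> else 0)"
| "walk_weight \<kappa> (Suc t) x = (if x < 0 then 0
     else (if x = 0 then \<kappa> else 1) * (walk_weight \<kappa> t (x - 1) + walk_weight \<kappa> t (x + 1)))"

lemma walk_weight_neg: "x < 0 \<Longrightarrow> walk_weight \<kappa> t x = 0"
  by (cases t) auto

lemma walk_weight_above: "int t < x \<Longrightarrow> walk_weight \<kappa> t x = 0"
  by (induction t arbitrary: x) auto

lemma walk_weight_diag: "walk_weight \<kappa> t (int t) = \<kappa>"
  by (induction t) (auto simp: walk_weight_above)

definition even_weight :: "real \<Rightarrow> nat \<Rightarrow> nat \<Rightarrow> real" where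
  "even_weight \<kappa> m k = walk_weight \<kappa> (2 * m) (2 * int k)"

lemma even_weight_0: "even_weight \<kappa> 0 k = (if k = 0 then \<kappa> else 0)"
  by (simp add: even_weight_def)

lemma even_weight_Suc_0:
  "even_weight \<kappa> (Suc m) 0 = \<kappa> * (even_weight \<kappa> m 0 + even_weight \<kappa> m 1)"
  by (simp add: even_weight_def walk_weight_neg)

lemma even_weight_Suc_Suc:
  "even_weight \<kappa> (Suc m) (Suc k) =
     even_weight \<kappa> m k + 2 * even_weight \<kappa> m (Suc k) + even_weight \<kappa> m (Suc (Suc k))"
  by (simp add: even_weight_def algebra_simps)

lemma even_weight_above: "m < k \<Longrightarrow> even_weight \<kappa> m k = 0"
  by (simp add: even_weight_def walk_weight_above)

lemma even_weight_diag: "even_weight \<kappa> m m = \<kappa>"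
  using walk_weight_diag[of \<kappa> "2 * m"] by (simp add: even_weight_def)

text \<open>Two walks glued at an axis point both count that contact; the factor
  \<open>1 / \<kappa>\<close> removes the duplicate.\<close>

definition site_weight :: "real \<Rightarrow> nat \<Rightarrow> real" where
  "site_weight \<kappa> k = (if k = 0 then 1 / \<kappa> else 1)"

text \<open>Discrete Green identity: the two-step transfer operator is self-adjoint with respect to
  the site weights, up to a boundary term.\<close>

lemma even_weight_green:
  assumes "\<kappa> \<noteq> 0"
  shows "(\<Sum>k\<le>N. site_weight \<kappa> k *
      (even_weight \<kappa> (Suc m) k * even_weight \<kappa> j k - even_weight \<kappa> m k * even_weight \<kappa> (Suc j) k)) =
    even_weight \<kappa> m (Suc N) * even_weight \<kappa> j N - even_weight \<kappa> m N * even_weight \<kappa> j (Suc N)"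
proof (induction N)
  case 0
  then show ?case using assms
    by (simp add: site_weight_def even_weight_Suc_0 field_simps)
next
  case (Suc N)
  then show ?case
    by (simp add: site_weight_def even_weight_Suc_Suc algebra_simps)
qed

text \<open>A closed walk of length 2(m + j) is cut at time 2m and its second half reversed. The
  proof moves double steps from one factor to the other by \<open>even_weight_green\<close>.\<close>

lemma even_weight_add:
  assumes "\<kappa> \<noteq> 0" "j \<le> N"
  shows "(\<Sum>k\<le>N. even_weight \<kappa> m k * (site_weight \<kappa> k * even_weight \<kappa> j k)) =
    even_weight \<kappa> (m + j) 0"
  using assms(2)
proof (induction j arbitrary: m)
  case 0
  have "(\<Sum>k\<le>N. even_weight \<kappa> m k * (site_weight \<kappa> k * even_weight \<kappa> 0 k)) =
      (\<Sum>k\<in>{0}. even_weight \<kappa> m k * (site_weight \<kappa> k * even_weight \<kappa> 0 k))"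
    by (intro sum.mono_neutral_right) (auto simp: even_weight_0)
  then show ?case using assms(1) by (simp add: even_weight_0 site_weight_def)
next
  case (Suc j)
  \<comment> \<open>The boundary term vanishes: \<open>j < N\<close>, so no walk of length 2j
    reaches height 2N or 2(N + 1).\<close>
  have "(\<Sum>k\<le>N. even_weight \<kappa> m k * (site_weight \<kappa> k * even_weight \<kappa> (Suc j) k)) =
      (\<Sum>k\<le>N. even_weight \<kappa> (Suc m) k * (site_weight \<kappa> k * even_weight \<kappa> j k))"
    using even_weight_green[OF assms(1), of m j N] Suc.prems
    by (simp add: even_weight_above right_diff_distrib sum_subtractf mult_ac)
  then show ?case using Suc by simp
qed

section \<open>Values and derivatives of the weights at \<open>\<kappa> = 2\<close>\<close>

text \<open>A factor 2 per contact is a choice of sign for the part of the walk that follows it, so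
  unconstrained walks are counted. The induction is Pascal's rule, closed at the axis by the
  symmetry of an odd row.\<close>

lemma even_weight_at_2: "even_weight 2 m k = 2 * real ((2 * m) choose (m + k))"
proof (induction m arbitrary: k)
  case 0
  then show ?case by (simp add: even_weight_0)
next
  case (Suc m)
  show ?case
  proof (cases k)
    case 0
    have "Suc (2 * m) choose m = Suc (2 * m) choose Suc m"
      using binomial_symmetric[of m "Suc (2 * m)"] by (simp add: mult_2)
    then show ?thesis using 0 by (simp add: even_weight_Suc_0 Suc.IH)
  next
    case (Suc l)
    then show ?thesis by (simp add: even_weight_Suc_Suc Suc.IH)
  qed
qed

text \<open>Closed form of the derivative at \<open>\<kappa> = 2\<close>. The upper half of row 2m +
  1 of Pascal's triangle sums to \<open>4 ^ m\<close>, so this is the sum of its entries beyond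
  position m + k. The summands stay unmerged to match Pascal's rule.\<close>

definition even_weight_deriv :: "nat \<Rightarrow> nat \<Rightarrow> real" where
  "even_weight_deriv m k =
     4 ^ m - (\<Sum>l<k. real ((2 * m) choose (m + l)) + real ((2 * m) choose Suc (m + l)))"

lemma even_weight_deriv_Suc_0:
  "even_weight_deriv (Suc m) 0 = even_weight 2 m 0 + even_weight 2 m 1
     + 2 * (even_weight_deriv m 0 + even_weight_deriv m 1)"
  by (simp add: even_weight_deriv_def even_weight_at_2)

lemma even_weight_deriv_Suc_Suc:
  "even_weight_deriv (Suc m) (Suc k) =
     even_weight_deriv m k + 2 * even_weight_deriv m (Suc k) + even_weight_deriv m (Suc (Suc k))"
proof (induction k)
  case 0
  have "Suc (2 * m) choose m = Suc (2 * m) choose Suc m"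
    using binomial_symmetric[of m "Suc (2 * m)"] by (simp add: mult_2)
  then show ?case by (simp add: even_weight_deriv_def)
next
  case (Suc k)
  then show ?case by (simp add: even_weight_deriv_def)
qed

lemma even_weight_has_derivative:
  "((\<lambda>\<kappa>. even_weight \<kappa> m k) has_real_derivative even_weight_deriv m k) (at 2)"
proof (induction m arbitrary: k)
  case 0
  have "even_weight_deriv 0 k = (if k = 0 then 1 else 0)"
    by (cases k) (auto simp: even_weight_deriv_def sum.lessThan_Suc_shift simp del: sum.lessThan_Suc)
  then show ?case by (cases k) (auto simp: even_weight_0)
next
  case (Suc m)
  note [derivative_intros] = Suc.IH
  show ?case
    by (cases k)
      (auto simp: even_weight_Suc_0 even_weight_Suc_Suc even_weight_deriv_Suc_0
         even_weight_deriv_Suc_Suc intro!: derivative_eq_intros)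
qed

section \<open>The Hankel determinant: factorization and derivative\<close>

definition hankel :: "real \<Rightarrow> nat \<Rightarrow> nat \<Rightarrow> real mat" where
  "hankel \<kappa> n r = mat n n (\<lambda>(i, j). even_weight \<kappa> (r + i + j) 0)"

lemma det_initial_weights:
  "Determinant.det (mat n n (\<lambda>(i, j). even_weight \<kappa> i j)) = \<kappa> ^ n"
  by (subst det_lower_triangular[where n = n])
    (auto simp: even_weight_above even_weight_diag prod_list_diag_prod)

text \<open>\<open>even_weight_add\<close> factors the Hankel matrix; the right factor is upper
  triangular with diagonal 1, \<open>\<kappa>\<close>, ..., \<open>\<kappa>\<close>, the site weight
  cancelling the corner entry.\<close>

lemma det_hankel:
  assumes "\<kappa> \<noteq> 0" "n \<ge> 1"
  shows "Determinant.det (hankel \<kappa> n r) =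
    \<kappa> ^ (n - 1) * Determinant.det (mat n n (\<lambda>(i, j). even_weight \<kappa> (r + i) j))"
proof -
  define B where "B = mat n n (\<lambda>(i, j). even_weight \<kappa> (r + i) j)"
  define C where "C = mat n n (\<lambda>(k, j). site_weight \<kappa> k * even_weight \<kappa> j k)"
  obtain N where N: "n = Suc N" using assms(2) by (cases n) auto
  have "hankel \<kappa> n r = B * C"
    by (rule eq_matI)
      (auto simp: hankel_def B_def C_def scalar_prod_def N even_weight_add[OF assms(1)]
        lessThan_Suc_atMost simp flip: lessThan_atLeast0)
  moreover have "Determinant.det C = prod_list (diag_mat C)"
    by (rule det_upper_triangular[where n = n])
      (auto simp: C_def even_weight_above upper_triangular_def)
  moreover have "prod_list (diag_mat C) = \<kappa> ^ (n - 1)"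
    using assms(1) by (simp add: C_def prod_list_diag_prod even_weight_diag N
      prod.atLeast0_lessThan_Suc_shift site_weight_def del: prod.op_ivl_Suc)
  ultimately show ?thesis
    using det_mult[of B n C] by (simp add: B_def C_def)
qed

text \<open>Differentiation column by column gives determinants with column \<open>k\<close>
  replaced by the powers \<open>4 ^ (r + i + k)\<close>. All these columns are proportional to the
  vector of the \<open>4 ^ i\<close>, and the kernel coefficients solve the system for it, so
  Cramer's rule evaluates each.\<close>

lemma det_hankel_has_derivative:
  "((\<lambda>\<kappa>. Determinant.det (hankel \<kappa> (Suc N) r)) has_real_derivative
     (\<Sum>k\<le>N. 4 ^ (r + k) * kernel_coeff r N k / 2) * Determinant.det (hankel 2 (Suc N) r)) (at 2)"
proof -
  define n where "n = Suc N"
  define A where "A = hankel 2 n r"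
  have A: "A \<in> carrier_mat n n" by (simp add: A_def hankel_def)
  have cramer: "Determinant.det (replace_col A (vec n (\<lambda>i. 4 ^ (r + i + k))) k) =
      4 ^ (r + k) * kernel_coeff r N k / 2 * Determinant.det A" if k: "k < n" for k
  proof -
    \<comment> \<open>The division by 2 compensates the factor 2 in
      \<open>even_weight_at_2\<close>.\<close>
    define x where "x = vec n (\<lambda>j. 4 ^ (r + k) * kernel_coeff r N j / 2)"
    have "A *\<^sub>v x = vec n (\<lambda>i. 4 ^ (r + i + k))"
    proof (rule eq_vecI)
      fix i assume i: "i < dim_vec (vec n (\<lambda>i. 4 ^ (r + i + k)) :: real vec)"
      then have "(A *\<^sub>v x) $ i = (\<Sum>j\<le>N. real ((2 * (r + i + j)) choose (r + i + j)) * (4 ^ (r + k) * kernel_coeff r N j))"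
        by (simp add: A_def hankel_def x_def scalar_prod_def even_weight_at_2 n_def lessThan_Suc_atMost
            flip: lessThan_atLeast0)
      also have "\<dots> = 4 ^ (r + k) * (\<Sum>j\<le>N. real ((2 * (r + i + j)) choose (r + i + j)) * kernel_coeff r N j)"
        by (simp add: sum_distrib_left mult_ac)
      also have "\<dots> = 4 ^ (r + k) * 4 ^ i"
        using i by (subst central_binomial_kernel_coeff) (auto simp: n_def)
      finally show "(A *\<^sub>v x) $ i = vec n (\<lambda>i. 4 ^ (r + i + k)) $ i"
        using i by (simp add: power_add)
    qed (simp add: A_def hankel_def)
    then show ?thesis
      using cramer_lemma_mat[OF A, of x k] k by (simp add: x_def)
  qed
  let ?P = "{p. p permutes {0..<n}}"
  \<comment> \<open>The Leibniz expansion has one factor per column, so the product-rule terms with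
    the same \<open>k\<close> reassemble into the determinant with column \<open>k\<close>
    replaced.\<close>
  have "((\<lambda>\<kappa>. \<Sum>p\<in>?P. signof p * (\<Prod>j<n. even_weight \<kappa> (r + p j + j) 0)) has_real_derivative
    (\<Sum>p\<in>?P. signof p * (\<Sum>k<n. 4 ^ (r + p k + k) *
       (\<Prod>j\<in>{..<n} - {k}. even_weight 2 (r + p j + j) 0)))) (at 2)"
    using even_weight_has_derivative[of _ 0]
    by (intro DERIV_sum DERIV_cmult has_field_derivative_prod) (simp add: even_weight_deriv_def)
  also have "(\<lambda>\<kappa>. \<Sum>p\<in>?P. signof p * (\<Prod>j<n. even_weight \<kappa> (r + p j + j) 0)) =
     (\<lambda>\<kappa>. Determinant.det (hankel \<kappa> n r))"
    by (rule ext, subst det_col[where n = n])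
      (auto simp: hankel_def permutes_in_image intro!: sum.cong prod.cong)
  also have "(\<Sum>p\<in>?P. signof p * (\<Sum>k<n. 4 ^ (r + p k + k) *
       (\<Prod>j\<in>{..<n} - {k}. even_weight 2 (r + p j + j) 0))) =
     (\<Sum>k<n. \<Sum>p\<in>?P. signof p * (4 ^ (r + p k + k) *
       (\<Prod>j\<in>{..<n} - {k}. even_weight 2 (r + p j + j) 0)))"
    unfolding sum_distrib_left by (rule sum.swap)
  also have "\<dots> = (\<Sum>k<n. Determinant.det (replace_col A (vec n (\<lambda>i. 4 ^ (r + i + k))) k))"
  proof (rule sum.cong[OF refl])
    fix k assume k: "k \<in> {..<n}"
    let ?R = "replace_col A (vec n (\<lambda>i. 4 ^ (r + i + k))) k"
    have "?R \<in> carrier_mat n n" using A by (simp add: replace_col_def)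
    moreover have "(\<Prod>j<n. ?R $$ (p j, j)) =
        4 ^ (r + p k + k) * (\<Prod>j\<in>{..<n} - {k}. even_weight 2 (r + p j + j) 0)"
      if "p permutes {0..<n}" for p
      using A k permutes_in_image[OF that]
      by (subst prod.remove[of _ k]) (auto simp: replace_col_def A_def hankel_def intro!: prod.cong)
    ultimately show "(\<Sum>p\<in>?P. signof p * (4 ^ (r + p k + k) *
       (\<Prod>j\<in>{..<n} - {k}. even_weight 2 (r + p j + j) 0))) = Determinant.det ?R"
      by (subst det_col[where n = n]) (auto intro!: sum.cong)
  qed
  also have "\<dots> = (\<Sum>k<n. 4 ^ (r + k) * kernel_coeff r N k / 2) * Determinant.det A"
    unfolding sum_distrib_right by (intro sum.cong) (auto simp: cramer)
  finally show ?thesis unfolding n_def A_def lessThan_Suc_atMost .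
qed

subsection \<open>Vicious families as determinants\<close>

text \<open>End heights are arbitrary, since removing the last steps destroys their equal
  spacing.\<close>

definition families :: "nat \<Rightarrow> nat \<Rightarrow> (nat \<Rightarrow> int) \<Rightarrow> (int \<times> int) list list set" where
  "families n t x = {Ps. length Ps = n \<and> vicious Ps \<and>
     (\<forall>i<n. walk_between (0, 2 * int i) (int t, x i) (Ps ! i))}"

lemma walk_append_last:
  assumes "Q \<noteq> []"
  shows "walk (Q @ [(c, d)]) \<longleftrightarrow> walk Q \<and> 0 \<le> d \<and>
    fst (last Q) + 1 = c \<and> (d = snd (last Q) + 1 \<or> d = snd (last Q) - 1)"
  using assms by (cases "last Q") (auto simp: walk_def successively_append_iff)

lemma walk_between_points:
  assumes "walk_between (0, a) (int t, b) P"
  shows "length P = Suc t" "k < length P \<Longrightarrow> fst (P ! k) = int k"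
proof -
  have w: "walk P" "P \<noteq> []" "hd P = (0, a)" "last P = (int t, b)"
    using assms by (auto simp: walk_between_def walk_def)
  have "int (length P - 1) = int t"
    using walk_points[OF w(1), of "length P - 1"] w by (simp add: last_conv_nth)
  then show "length P = Suc t" using w(2) by (cases P) auto
  show "k < length P \<Longrightarrow> fst (P ! k) = int k"
    using walk_points[OF w(1), of k] w by simp
qed

lemma walk_between_fst_le:
  assumes "walk_between (0, a) (int t, b) P" "p \<in> set P"
  shows "fst p \<le> int t"
  using assms walk_between_points[OF assms(1)] by (auto simp: in_set_conv_nth)

lemma walk_between_last_in: "walk_between u v P \<Longrightarrow> v \<in> set P"
  by (metis last_in_set walk_between_def walk_def)

lemma walk_between_nonneg: "walk_between u v P \<Longrightarrow> 0 \<le> snd v"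
  using walk_between_last_in[of u v P] by (auto simp: walk_between_def walk_def)

lemma walk_between_0: "walk_between (0, a) (0, b) P \<longleftrightarrow> P = [(0, a)] \<and> a = b \<and> 0 \<le> a"
proof
  assume w: "walk_between (0, a) (0, b) P"
  then have "length P = 1" using walk_between_points(1)[of a 0 b P] by simp
  then obtain p where "P = [p]" by (auto simp: length_Suc_conv)
  then show "P = [(0, a)] \<and> a = b \<and> 0 \<le> a"
    using w walk_between_nonneg[OF w] by (auto simp: walk_between_def)
qed (auto simp: walk_between_def walk_def)

lemma walk_between_Suc:
  "walk_between (0, a) (int (Suc t), b) P \<longleftrightarrow>
     (\<exists>Q. P = Q @ [(int (Suc t), b)] \<and> 0 \<le> b \<and>
        (walk_between (0, a) (int t, b - 1) Q \<or> walk_between (0, a) (int t, b + 1) Q))"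
proof
  assume w: "walk_between (0, a) (int (Suc t), b) P"
  then have len: "length P = Suc (Suc t)" by (rule walk_between_points(1))
  define Q where "Q = butlast P"
  have Q: "Q \<noteq> []" using len by (auto simp: Q_def butlast_conv_take)
  have P: "P = Q @ [(int (Suc t), b)]"
    using w len by (metis Q_def append_butlast_last_id length_0_conv nat.distinct(1) walk_between_def)
  have "walk (Q @ [(int (Suc t), b)])" using w P by (simp add: walk_between_def)
  then have "walk Q" "0 \<le> b" "fst (last Q) = int t" "b = snd (last Q) + 1 \<or> b = snd (last Q) - 1"
    unfolding walk_append_last[OF Q] by auto
  moreover have "hd Q = (0, a)" using w P Q by (simp add: walk_between_def)
  ultimately show "\<exists>Q. P = Q @ [(int (Suc t), b)] \<and> 0 \<le> b \<and>
        (walk_between (0, a) (int t, b - 1) Q \<or> walk_between (0, a) (int t, b + 1) Q)"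
    using P by (intro exI[of _ Q]) (cases "last Q", auto simp: walk_between_def)
next
  assume "\<exists>Q. P = Q @ [(int (Suc t), b)] \<and> 0 \<le> b \<and>
        (walk_between (0, a) (int t, b - 1) Q \<or> walk_between (0, a) (int t, b + 1) Q)"
  then obtain Q where Q: "P = Q @ [(int (Suc t), b)]" "0 \<le> b"
    "walk_between (0, a) (int t, b - 1) Q \<or> walk_between (0, a) (int t, b + 1) Q" by blast
  then have "Q \<noteq> []" by (auto simp: walk_between_def walk_def)
  then show "walk_between (0, a) (int (Suc t), b) P"
    unfolding walk_between_def Q(1) walk_append_last[OF \<open>Q \<noteq> []\<close>]
    using Q by (auto simp: walk_between_def)
qed

section \<open>Recursion for vicious families by their last steps\<close>

text \<open>The heights one step earlier, where \<open>S\<close> is the set of walks whose last step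
  goes up.\<close>

definition shift :: "(nat \<Rightarrow> int) \<Rightarrow> nat set \<Rightarrow> nat \<Rightarrow> int" where
  "shift x S i = (if i \<in> S then x i - 1 else x i + 1)"

definition extend :: "nat \<Rightarrow> (nat \<Rightarrow> int) \<Rightarrow> (int \<times> int) list list \<Rightarrow> (int \<times> int) list list" where
  "extend t x Qs = map (\<lambda>i. Qs ! i @ [(int (Suc t), x i)]) [0..<length Qs]"

text \<open>The new points have abscissa t + 1, beyond every old point, so distinct end heights
  suffice to keep the walks disjoint.\<close>

lemma extend_in_families:
  assumes inj: "inj_on x {..<n}" and nonneg: "\<forall>i<n. 0 \<le> x i"
    and Qs: "Qs \<in> families n t (shift x S)"
  shows "extend t x Qs \<in> families n (Suc t) x"
proof -
  have len: "length Qs = n" and vic: "vicious Qs"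
    and wb: "\<And>i. i < n \<Longrightarrow> walk_between (0, 2 * int i) (int t, shift x S i) (Qs ! i)"
    using Qs by (auto simp: families_def)
  have new: "(int (Suc t), b) \<notin> set (Qs ! i)" if "i < n" for i b
    using walk_between_fst_le[OF wb[OF that]] by fastforce
  have "vicious (extend t x Qs)"
    unfolding vicious_def
  proof (intro allI impI)
    fix i j assume ij: "i < length (extend t x Qs)" "j < length (extend t x Qs)" "i \<noteq> j"
    then have "x i \<noteq> x j" using inj len by (auto simp: extend_def inj_on_def)
    moreover have "set (Qs ! i) \<inter> set (Qs ! j) = {}"
      using vic ij by (auto simp: vicious_def extend_def)
    ultimately show "set (extend t x Qs ! i) \<inter> set (extend t x Qs ! j) = {}"
      using ij new len by (auto simp: extend_def)
  qed
  moreover have "walk_between (0, 2 * int i) (int (Suc t), x i) (extend t x Qs ! i)" if "i < n" for i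
    unfolding walk_between_Suc using wb[OF that] nonneg that len
    by (auto simp: extend_def shift_def split: if_splits)
  ultimately show ?thesis by (simp add: families_def extend_def len)
qed

lemma families_Suc:
  assumes inj: "inj_on x {..<n}" and nonneg: "\<forall>i<n. 0 \<le> x i"
  shows "families n (Suc t) x = (\<Union>S\<in>Pow {..<n}. extend t x ` families n t (shift x S))"
proof (intro equalityI subsetI)
  fix Ps assume Ps: "Ps \<in> families n (Suc t) x"
  then have len: "length Ps = n" and vic: "vicious Ps"
    and wb: "\<And>i. i < n \<Longrightarrow> walk_between (0, 2 * int i) (int (Suc t), x i) (Ps ! i)"
    by (auto simp: families_def)
  have "\<exists>Q. Ps ! i = Q @ [(int (Suc t), x i)] \<and>
        (walk_between (0, 2 * int i) (int t, x i - 1) Q \<or> walk_between (0, 2 * int i) (int t, x i + 1) Q)"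
    if "i < n" for i
    using wb[OF that] unfolding walk_between_Suc by blast
  then obtain Q where Q: "\<And>i. i < n \<Longrightarrow> Ps ! i = Q i @ [(int (Suc t), x i)]"
    "\<And>i. i < n \<Longrightarrow> walk_between (0, 2 * int i) (int t, x i - 1) (Q i) \<or>
        walk_between (0, 2 * int i) (int t, x i + 1) (Q i)"
    by metis
  define S where "S = {i. i < n \<and> walk_between (0, 2 * int i) (int t, x i - 1) (Q i)}"
  define Qs where "Qs = map Q [0..<n]"
  have "Ps = extend t x Qs"
    by (rule nth_equalityI) (auto simp: extend_def Qs_def len Q(1))
  moreover have "vicious Qs"
    unfolding vicious_def
  proof (intro allI impI)
    fix i j assume ij: "i < length Qs" "j < length Qs" "i \<noteq> j"
    then have "set (Ps ! i) \<inter> set (Ps ! j) = {}" using vic len by (auto simp: vicious_def Qs_def)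
    then show "set (Qs ! i) \<inter> set (Qs ! j) = {}" using ij by (auto simp: Qs_def Q(1))
  qed
  then have "Qs \<in> families n t (shift x S)"
    using Q(2) by (auto simp: families_def Qs_def shift_def S_def)
  ultimately show "Ps \<in> (\<Union>S\<in>Pow {..<n}. extend t x ` families n t (shift x S))"
    by (auto simp: S_def)
next
  fix Ps assume "Ps \<in> (\<Union>S\<in>Pow {..<n}. extend t x ` families n t (shift x S))"
  then show "Ps \<in> families n (Suc t) x"
    using extend_in_families[OF inj nonneg] by auto
qed

lemma families_nonempty_imp:
  assumes "Ps \<in> families n t x"
  shows "inj_on x {..<n}" "i < n \<Longrightarrow> 0 \<le> x i"
proof -
  have len: "length Ps = n" and vic: "vicious Ps"
    and wb: "\<And>i. i < n \<Longrightarrow> walk_between (0, 2 * int i) (int t, x i) (Ps ! i)"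
    using assms by (auto simp: families_def)
  show "i < n \<Longrightarrow> 0 \<le> x i" using walk_between_nonneg[OF wb] by simp
  show "inj_on x {..<n}"
  proof (rule inj_onI, rule ccontr)
    fix i j assume ij: "i \<in> {..<n}" "j \<in> {..<n}" "x i = x j" "i \<noteq> j"
    then have "(int t, x i) \<in> set (Ps ! i) \<inter> set (Ps ! j)"
      using walk_between_last_in[OF wb, of i] walk_between_last_in[OF wb, of j] by simp
    moreover have "set (Ps ! i) \<inter> set (Ps ! j) = {}"
      using vic ij len by (simp add: vicious_def)
    ultimately show False by simp
  qed
qed

lemma families_empty:
  "\<not> (inj_on x {..<n} \<and> (\<forall>i<n. 0 \<le> x i)) \<Longrightarrow> families n t x = {}"
  using families_nonempty_imp by blast

lemma families_0:
  "families n 0 x = (if \<forall>i<n. x i = 2 * int i then {map (\<lambda>i. [(0, 2 * int i)]) [0..<n]} else {})"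
proof -
  have "vicious (map (\<lambda>i. [(0, 2 * int i)]) [0..<n])" by (auto simp: vicious_def)
  then show ?thesis
    by (auto simp: families_def walk_between_0 intro!: nth_equalityI)
qed

lemma finite_families: "finite (families n t x)"
proof (induction t arbitrary: x)
  case 0
  then show ?case by (simp add: families_0)
next
  case (Suc t)
  show ?case
  proof (cases "inj_on x {..<n} \<and> (\<forall>i<n. 0 \<le> x i)")
    case True
    then have "families n (Suc t) x = (\<Union>S\<in>Pow {..<n}. extend t x ` families n t (shift x S))"
      by (intro families_Suc) auto
    then show ?thesis using Suc.IH by simp
  next
    case False
    then show ?thesis by (simp add: families_empty)
  qed
qed

lemma contacts_extend:
  assumes inj: "inj_on x {..<n}" and Qs: "Qs \<in> families n t y"
  shows "contacts (extend t x Qs) = contacts Qs + card {i. i < n \<and> x i = 0}"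
proof -
  have len: "length Qs = n"
    and wb: "\<And>i. i < n \<Longrightarrow> walk_between (0, 2 * int i) (int t, y i) (Qs ! i)"
    using Qs by (auto simp: families_def)
  have Qs_eq: "set Qs = (!) Qs ` {..<n}" and
    ext_eq: "set (extend t x Qs) = (\<lambda>i. Qs ! i @ [(int (Suc t), x i)]) ` {..<n}"
    by (auto simp: extend_def len in_set_conv_nth)
  let ?A = "{p. (\<exists>P\<in>set Qs. p \<in> set P) \<and> snd p = 0}"
  let ?B = "(\<lambda>i. (int (Suc t), x i)) ` {i. i < n \<and> x i = 0}"
  have "{p. (\<exists>P\<in>set (extend t x Qs). p \<in> set P) \<and> snd p = 0} = ?A \<union> ?B"
    unfolding Qs_eq ext_eq by auto
  moreover have "?A \<inter> ?B = {}"
    unfolding Qs_eq using walk_between_fst_le[OF wb] by fastforce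
  moreover have "finite ?A"
    by (rule finite_subset[of _ "\<Union>(set ` set Qs)"]) auto
  moreover have "card ?B = card {i. i < n \<and> x i = 0}"
    using inj by (intro card_image) (auto simp: inj_on_def)
  ultimately show ?thesis by (simp add: contacts_def card_Un_disjoint)
qed

definition family_weight :: "real \<Rightarrow> nat \<Rightarrow> nat \<Rightarrow> (nat \<Rightarrow> int) \<Rightarrow> real" where
  "family_weight \<kappa> n t x = (\<Sum>Ps\<in>families n t x. \<kappa> ^ contacts Ps)"

lemma inj_on_extend: "inj_on (extend t x) (families n t y)"
proof (rule inj_onI)
  fix Ps Qs assume "Ps \<in> families n t y" "Qs \<in> families n t y" and e: "extend t x Ps = extend t x Qs"
  then have len: "length Ps = n" "length Qs = n" by (auto simp: families_def)
  show "Ps = Qs"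
  proof (rule nth_equalityI)
    fix i assume "i < length Ps"
    then show "Ps ! i = Qs ! i" using arg_cong[OF e, of "\<lambda>Rs. Rs ! i"] len by (simp add: extend_def)
  qed (simp add: len)
qed

lemma extend_disjoint:
  assumes "S \<subseteq> {..<n}" "S' \<subseteq> {..<n}" "S \<noteq> S'"
  shows "extend t x ` families n t (shift x S) \<inter> extend t x ` families n t (shift x S') = {}"
proof (rule ccontr)
  assume "\<not> ?thesis"
  then obtain Ps Qs where P: "Ps \<in> families n t (shift x S)" and Q: "Qs \<in> families n t (shift x S')"
    and e: "extend t x Ps = extend t x Qs" by auto
  have len: "length Ps = n" "length Qs = n" using P Q by (auto simp: families_def)
  have "shift x S i = shift x S' i" if "i < n" for i
  proof -
    have "Ps ! i = Qs ! i" using arg_cong[OF e, of "\<lambda>Rs. Rs ! i"] len that by (simp add: extend_def)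
    moreover have "last (Ps ! i) = (int t, shift x S i)" "last (Qs ! i) = (int t, shift x S' i)"
      using P Q that by (auto simp: families_def walk_between_def)
    ultimately show ?thesis by simp
  qed
  then have "i \<in> S \<longleftrightarrow> i \<in> S'" if "i < n" for i
    using that by (fastforce simp: shift_def split: if_splits)
  then have "S = S'" using assms(1,2) by auto
  with assms(3) show False by simp
qed

text \<open>The last points of the truncated walks determine \<open>S\<close>, so the union in
  \<open>families_Suc\<close> is disjoint and the new contacts contribute a common factor.\<close>

lemma family_weight_Suc:
  assumes inj: "inj_on x {..<n}" and nonneg: "\<forall>i<n. 0 \<le> x i"
  shows "family_weight \<kappa> n (Suc t) x =
    \<kappa> ^ card {i. i < n \<and> x i = 0} * (\<Sum>S\<in>Pow {..<n}. family_weight \<kappa> n t (shift x S))"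
proof -
  have "family_weight \<kappa> n (Suc t) x =
      (\<Sum>S\<in>Pow {..<n}. \<Sum>Ps\<in>extend t x ` families n t (shift x S). \<kappa> ^ contacts Ps)"
    unfolding family_weight_def families_Suc[OF inj nonneg]
    by (rule sum.UNION_disjoint) (auto simp: finite_families extend_disjoint)
  also have "\<dots> = (\<Sum>S\<in>Pow {..<n}. \<kappa> ^ card {i. i < n \<and> x i = 0} * family_weight \<kappa> n t (shift x S))"
    unfolding sum.reindex[OF inj_on_extend] family_weight_def sum_distrib_left
    by (intro sum.cong) (auto simp: contacts_extend[OF inj] power_add)
  finally show ?thesis by (simp add: sum_distrib_left)
qed

section \<open>The determinant with the same recursion\<close>

text \<open>Row \<open>i\<close> belongs to the starting point (-2i, 0), whose walk reaches abscissa
  \<open>t\<close> after t + 2i steps; viciousness would force that walk straight up to (0,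
  2i).\<close>

definition weight_det :: "real \<Rightarrow> nat \<Rightarrow> nat \<Rightarrow> (nat \<Rightarrow> int) \<Rightarrow> real" where
  "weight_det \<kappa> n t x = Determinant.det (mat n n (\<lambda>(i, j). walk_weight \<kappa> (t + 2 * i) (x j)))"

lemma weight_det_leibniz:
  "weight_det \<kappa> n t x =
     (\<Sum>p | p permutes {0..<n}. signof p * (\<Prod>j<n. walk_weight \<kappa> (t + 2 * p j) (x j)))"
  unfolding weight_det_def
  by (subst det_col[where n = n]) (auto simp: permutes_in_image intro!: sum.cong prod.cong)

lemma weight_det_zero_col:
  assumes "j < n" "\<And>i. i < n \<Longrightarrow> walk_weight \<kappa> (t + 2 * i) (x j) = 0"
  shows "weight_det \<kappa> n t x = 0"
  unfolding weight_det_leibniz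
proof (rule sum.neutral, safe)
  fix p assume "p permutes {0..<n}"
  then have "p j < n" using permutes_in_image[of p "{0..<n}" j] assms(1) by simp
  then show "signof p * (\<Prod>j<n. walk_weight \<kappa> (t + 2 * p j) (x j)) = 0"
    using assms by auto
qed

lemma weight_det_equal_cols:
  assumes "i < n" "j < n" "i \<noteq> j" "x i = x j"
  shows "weight_det \<kappa> n t x = 0"
  unfolding weight_det_def
  by (rule det_identical_columns[where n = n and i = i and j = j])
    (use assms in \<open>auto intro!: eq_vecI\<close>)

lemma weight_det_degenerate:
  assumes "\<not> (inj_on x {..<n} \<and> (\<forall>i<n. 0 \<le> x i))"
  shows "weight_det \<kappa> n t x = 0"
proof (cases "inj_on x {..<n}")
  case True
  then obtain i where "i < n" "x i < 0" using assms by auto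
  then show ?thesis by (intro weight_det_zero_col[of i]) (auto simp: walk_weight_neg)
next
  case False
  then show ?thesis using weight_det_equal_cols by (auto simp: inj_on_def)
qed

text \<open>Multilinearity in the columns: each one is a contact factor times a sum of two columns
  at time \<open>t\<close>, and \<open>S\<close> records which of the two is chosen.\<close>

lemma weight_det_Suc:
  assumes nonneg: "\<forall>i<n. 0 \<le> x i"
  shows "weight_det \<kappa> n (Suc t) x =
    \<kappa> ^ card {i. i < n \<and> x i = 0} * (\<Sum>S\<in>Pow {..<n}. weight_det \<kappa> n t (shift x S))"
proof -
  let ?w = "walk_weight \<kappa>" and ?c = "\<kappa> ^ card {i. i < n \<and> x i = 0}"
  have c: "(\<Prod>j<n. if x j = 0 then \<kappa> else 1) = ?c"
    by (simp add: prod.If_cases lessThan_def Int_def)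
  have "(\<Prod>j<n. ?w (Suc t + 2 * p j) (x j)) =
      ?c * (\<Sum>S\<in>Pow {..<n}. \<Prod>j<n. ?w (t + 2 * p j) (shift x S j))" for p
  proof -
    have "(\<Prod>j<n. ?w (Suc t + 2 * p j) (x j)) =
       (\<Prod>j<n. (if x j = 0 then \<kappa> else 1) *
          (?w (t + 2 * p j) (x j - 1) + ?w (t + 2 * p j) (x j + 1)))"
      using nonneg by (intro prod.cong) fastforce+
    also have "\<dots> = ?c * (\<Sum>S\<in>Pow {..<n}. (\<Prod>j\<in>S. ?w (t + 2 * p j) (x j - 1)) *
        (\<Prod>j\<in>{..<n} - S. ?w (t + 2 * p j) (x j + 1)))"
      unfolding prod.distrib c by (simp add: prod_add)
    also have "(\<Sum>S\<in>Pow {..<n}. (\<Prod>j\<in>S. ?w (t + 2 * p j) (x j - 1)) *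
        (\<Prod>j\<in>{..<n} - S. ?w (t + 2 * p j) (x j + 1))) =
       (\<Sum>S\<in>Pow {..<n}. \<Prod>j<n. ?w (t + 2 * p j) (shift x S j))"
    proof (rule sum.cong[OF refl])
      fix S assume S: "S \<in> Pow {..<n}"
      have "(\<Prod>j<n. ?w (t + 2 * p j) (shift x S j)) =
         (\<Prod>j\<in>{..<n} - S. ?w (t + 2 * p j) (shift x S j)) * (\<Prod>j\<in>S. ?w (t + 2 * p j) (shift x S j))"
        using S by (intro prod.subset_diff) auto
      then show "(\<Prod>j\<in>S. ?w (t + 2 * p j) (x j - 1)) *
        (\<Prod>j\<in>{..<n} - S. ?w (t + 2 * p j) (x j + 1)) = (\<Prod>j<n. ?w (t + 2 * p j) (shift x S j))"
        by (simp add: shift_def mult.commute)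
    qed
    finally show ?thesis .
  qed
  then have "weight_det \<kappa> n (Suc t) x = (\<Sum>p | p permutes {0..<n}. \<Sum>S\<in>Pow {..<n}.
      ?c * (signof p * (\<Prod>j<n. ?w (t + 2 * p j) (shift x S j))))"
    unfolding weight_det_leibniz by (simp add: sum_distrib_left mult_ac)
  also have "\<dots> = ?c * (\<Sum>S\<in>Pow {..<n}. weight_det \<kappa> n t (shift x S))"
    unfolding weight_det_leibniz sum_distrib_left by (rule sum.swap)
  finally show ?thesis .
qed

text \<open>For end points 0, 2, 4, ... the only contact is the origin and the determinant is
  \<open>\<kappa> ^ n\<close>. For any others both sides vanish.\<close>

lemma family_weight_0:
  assumes n: "n \<ge> 1" and inc: "\<And>i j. i < j \<Longrightarrow> j < n \<Longrightarrow> x i < x j"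
    and even: "\<And>i. i < n \<Longrightarrow> even (x i)" and nonneg: "\<forall>i<n. 0 \<le> x i"
  shows "\<kappa> ^ (n - 1) * family_weight \<kappa> n 0 x = weight_det \<kappa> n 0 x"
proof (cases "\<forall>i<n. x i = 2 * int i")
  case True
  let ?Ps = "map (\<lambda>i. [(0, 2 * int i)]) [0..<n]"
  have Ps: "{p. (\<exists>P\<in>set ?Ps. p \<in> set P) \<and> snd p = 0} = {(0, 0)}" using n by auto
  have "contacts ?Ps = 1" unfolding contacts_def Ps by simp
  then have "family_weight \<kappa> n 0 x = \<kappa>" using True by (simp add: family_weight_def families_0)
  moreover have "weight_det \<kappa> n 0 x = Determinant.det (mat n n (\<lambda>(i, j). even_weight \<kappa> i j))"
    using True unfolding weight_det_def
    by (intro arg_cong[of _ _ Determinant.det] eq_matI) (auto simp: even_weight_def)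
  ultimately show ?thesis using n by (simp add: det_initial_weights flip: power_Suc2)
next
  case False
  have gap: "x i + 2 * int d \<le> x (i + d)" if "i + d < n" for i d
    using that
  proof (induction d)
    case (Suc d)
    then have "x (i + d) < x (i + Suc d)" "even (x (i + d))" "even (x (i + Suc d))"
      using inc even by auto
    then have "x (i + d) + 2 \<le> x (i + Suc d)" by presburger
    then show ?case using Suc by simp
  qed simp
  obtain i where i: "i < n" "x i \<noteq> 2 * int i" using False by auto
  \<comment> \<open>One excess height propagates to the last index, where it exceeds the length of
    every walk in that column.\<close>
  have "2 * int i \<le> x i" using gap[of 0 i] i nonneg[rule_format, of 0] n by simp
  then have "2 * int (n - 1) < x (n - 1)" using gap[of i "n - 1 - i"] i by simp
  then have "weight_det \<kappa> n 0 x = 0"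
    by (intro weight_det_zero_col[of "n - 1"] walk_weight_above) (use n in auto)
  moreover have "families n 0 x = {}" unfolding families_0 using False by (rule if_not_P)
  ultimately show ?thesis by (simp add: family_weight_def)
qed

text \<open>End points that coincide or lie below the axis are included because one step backwards
  from an admissible configuration can lead to them; there both sides vanish.\<close>

lemma family_weight_eq_det:
  assumes n: "n \<ge> 1" and mono: "\<And>i j. i < j \<Longrightarrow> j < n \<Longrightarrow> x i \<le> x j"
    and parity: "\<And>i. i < n \<Longrightarrow> even (x i - int t)"
  shows "\<kappa> ^ (n - 1) * family_weight \<kappa> n t x = weight_det \<kappa> n t x"
  using mono parity
proof (induction t arbitrary: x)
  case 0
  show ?case
  proof (cases "inj_on x {..<n} \<and> (\<forall>i<n. 0 \<le> x i)")
    case False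
    then show ?thesis
      by (simp only: family_weight_def families_empty[OF False] weight_det_degenerate[OF False] sum.empty mult_zero_right)
  next
    case True
    then have "x i < x j" if "i < j" "j < n" for i j
      using "0.prems"(1)[OF that] inj_onD[of x "{..<n}" i j] that by fastforce
    then show ?thesis using "0.prems" True by (intro family_weight_0[OF n]) auto
  qed
next
  case (Suc t)
  show ?case
  proof (cases "inj_on x {..<n} \<and> (\<forall>i<n. 0 \<le> x i)")
    case False
    then show ?thesis
      by (simp only: family_weight_def families_empty[OF False] weight_det_degenerate[OF False] sum.empty mult_zero_right)
  next
    case True
    then have inj: "inj_on x {..<n}" and nonneg: "\<forall>i<n. 0 \<le> x i"
      by auto
    have IH: "\<kappa> ^ (n - 1) * family_weight \<kappa> n t (shift x S) = weight_det \<kappa> n t (shift x S)" for S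
    proof (rule Suc.IH)
      fix i j assume ij: "i < j" "j < n"
      then have "x i \<le> x j" "even (x i - int (Suc t))" "even (x j - int (Suc t))"
        using Suc.prems by auto
      moreover have "x i \<noteq> x j" using inj_onD[OF inj, of i j] ij by auto
      \<comment> \<open>Equal parity turns strict order into a gap of 2, so opposite unit shifts can
        make end points meet but not cross. Hence the hypothesis asks only for weak
        monotonicity.\<close>
      ultimately have "x i + 2 \<le> x j" by presburger
      then show "shift x S i \<le> shift x S j" by (auto simp: shift_def)
    next
      fix i assume "i < n"
      then show "even (shift x S i - int t)" using Suc.prems(2)[of i] by (auto simp: shift_def)
    qed
    have "(\<Sum>S\<in>Pow {..<n}. weight_det \<kappa> n t (shift x S)) =
        \<kappa> ^ (n - 1) * (\<Sum>S\<in>Pow {..<n}. family_weight \<kappa> n t (shift x S))"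
      unfolding sum_distrib_left IH ..
    then show ?thesis
      unfolding family_weight_Suc[OF inj nonneg] weight_det_Suc[OF nonneg]
      by (simp only: mult.left_commute)
  qed
qed

section \<open>Return to the partition function\<close>

lemma vicious_families_eq: "vicious_families n t y = families n t (\<lambda>i. y + 2 * int i)"
  by (simp add: vicious_families_def families_def)

text \<open>One factor \<open>\<kappa> ^ N\<close> comes from the added starting points on the axis,
  the other from the triangular factor in \<open>det_hankel\<close>.\<close>

lemma det_hankel_partition_function:
  assumes "\<kappa> \<noteq> 0"
  shows "Determinant.det (hankel \<kappa> (Suc N) r) = \<kappa> ^ (2 * N) * partition_function (Suc N) (2 * r) 0 \<kappa>"
proof -
  have "\<kappa> ^ N * partition_function (Suc N) (2 * r) 0 \<kappa> = weight_det \<kappa> (Suc N) (2 * r) (\<lambda>i. 2 * int i)"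
    using family_weight_eq_det[of "Suc N" "\<lambda>i. 2 * int i" "2 * r" \<kappa>]
    by (simp add: partition_function_def family_weight_def vicious_families_eq)
  also have "\<dots> = Determinant.det (mat (Suc N) (Suc N) (\<lambda>(i, j). even_weight \<kappa> (r + i) j))"
    unfolding weight_det_def
    by (intro arg_cong[of _ _ Determinant.det] eq_matI) (auto simp: even_weight_def)
  finally show ?thesis using det_hankel[OF assms, of "Suc N" r]
    by (simp add: mult_2 power_add mult.assoc)
qed

text \<open>All walks alternate up and down in parallel. This makes the partition function positive
  for positive \<open>\<kappa>\<close>, so the quotient defining the mean is genuine.\<close>

lemma zigzag_families_nonempty: "families n t (\<lambda>i. 2 * int i + int (t mod 2)) \<noteq> {}"
proof (induction t)
  case 0
  then show ?case by (simp add: families_0)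
next
  case (Suc t)
  define x where "x = (\<lambda>i. 2 * int i + int (Suc t mod 2))"
  define S where "S = (if even t then {..<n} else {})"
  have "families n t (shift x S) = families n t (\<lambda>i. 2 * int i + int (t mod 2))"
    by (auto simp: families_def shift_def x_def S_def mod2_eq_if)
  then obtain Qs where "Qs \<in> families n t (shift x S)" using Suc.IH by auto
  then have "extend t x Qs \<in> families n (Suc t) x"
    by (intro extend_in_families) (auto simp: x_def inj_on_def)
  then show ?case by (auto simp: x_def)
qed

lemma partition_function_pos:
  assumes "\<kappa> > 0"
  shows "partition_function n (2 * r) 0 \<kappa> > 0"
  unfolding partition_function_def
  using zigzag_families_nonempty[of n "2 * r"] assms finite_vicious_families[of n "2 * r" 0]
  by (intro sum_pos) (auto simp: vicious_families_eq)

theorem theorem14: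
  fixes n r :: nat
  assumes "n \<ge> 1"
  shows "mean_contacts n (2 * r) 0 2 =
    2 powi (2 * int r - 1) * real n * real ((2 * n) choose n) /
      real ((2 * r + 2 * n - 2) choose (r + n - 1))
    - 2 * (real n - 1)"
proof -
  obtain N where n: "n = Suc N" using assms by (cases n) auto
  define Z where "Z = partition_function n (2 * r) 0"
  define H where "H = (\<lambda>\<kappa>. Determinant.det (hankel \<kappa> n r))"
  define c where "c = (\<Sum>k\<le>N. 4 ^ (r + k) * kernel_coeff r N k / 2)"
  have HZ: "H \<kappa> = \<kappa> ^ (2 * N) * Z \<kappa>" if "\<kappa> \<noteq> 0" for \<kappa>
    using det_hankel_partition_function[OF that] by (simp add: H_def Z_def n)
  have "Z = (\<lambda>\<kappa>. \<Sum>Ps\<in>vicious_families n (2 * r) 0. \<kappa> ^ contacts Ps)"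
    by (simp add: Z_def partition_function_def[abs_def])
  then have "Z field_differentiable at 2"
    by (auto intro!: derivative_intros)
  then have Z: "(Z has_real_derivative deriv Z 2) (at 2)"
    by (simp add: DERIV_deriv_iff_field_differentiable)
  have "((\<lambda>\<kappa>. \<kappa> ^ (2 * N) * Z \<kappa>) has_real_derivative
      2 ^ (2 * N) * deriv Z 2 + real (2 * N) * 2 ^ (2 * N - 1) * Z 2) (at 2)"
    by (auto intro!: derivative_eq_intros Z)
  \<comment> \<open>\<open>HZ\<close> excludes \<open>\<kappa> = 0\<close>, but equality near 2 is
    enough to transfer the derivative.\<close>
  moreover have "eventually (\<lambda>\<kappa>. H \<kappa> = \<kappa> ^ (2 * N) * Z \<kappa>) (nhds (2 :: real))"
    using eventually_nhds_in_open[of "{0<..}" "2 :: real"] by (auto elim!: eventually_mono simp: HZ)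
  ultimately have "(H has_real_derivative
      2 ^ (2 * N) * deriv Z 2 + real (2 * N) * 2 ^ (2 * N - 1) * Z 2) (at 2)"
    by (subst DERIV_cong_ev[OF refl _ refl]) auto
  moreover have "(H has_real_derivative c * H 2) (at 2)"
    using det_hankel_has_derivative[of N r] by (simp add: H_def c_def n)
  ultimately have "2 ^ (2 * N) * deriv Z 2 + real (2 * N) * 2 ^ (2 * N - 1) * Z 2 = c * H 2"
    by (rule DERIV_unique)
  also have "\<dots> = 2 ^ (2 * N) * (c * Z 2)" by (simp add: HZ)
  \<comment> \<open>For \<open>N = 0\<close> the exponent is truncated, but its coefficient is
    zero.\<close>
  also have "real (2 * N) * 2 ^ (2 * N - 1) * Z 2 = 2 ^ (2 * N) * (real N * Z 2)"
    by (cases N) auto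
  finally have "2 ^ (2 * N) * (deriv Z 2 + real N * Z 2) = 2 ^ (2 * N) * (c * Z 2)"
    by (simp only: distrib_left)
  then have "deriv Z 2 + real N * Z 2 = c * Z 2" by simp
  then have "deriv Z 2 = (c - real N) * Z 2" by (simp add: algebra_simps)
  moreover have "Z 2 > 0" by (simp add: Z_def partition_function_pos)
  ultimately have "mean_contacts n (2 * r) 0 2 = 2 * c - 2 * real N"
    by (simp add: mean_contacts_def Z_def)
  also have "c = 4 ^ r / 2 * (\<Sum>k\<le>N. 4 ^ k * kernel_coeff r N k)"
    by (simp add: c_def sum_distrib_left power_add mult.assoc)
  also have "2 * \<dots> = (4 ^ r / 2) * real n * real ((2 * n) choose n) / real ((2 * (r + N)) choose (r + N))"
    unfolding kernel_coeff_at_endpoint n by simp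
  \<comment> \<open>An integer exponent, since it equals -1 for \<open>r = 0\<close>.\<close>
  also have "(4 ^ r / 2 :: real) = 2 powi (2 * int r - 1)"
    by (simp add: power_int_diff power_int_mult)
  finally show ?thesis by (simp add: n add_mult_distrib2)
qed

end
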